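(* Let $\mu>0$ be a constant and let $f\colon[0,\infty)\to\mathbb{R}$ be such that the integrals $$\int_0^\infty\sin(\mu s)f(s)\,ds,\qquad \int_0^\infty\cos(\mu s)f(s)\,ds$$ are convergent in the Riemann sense. Then the problem $$\begin{cases}y''(t)+\mu^2y(t)=f(t)&\text{for }t\ge0,\\ \lim\limits_{t\to\infty}y(t)=0\end{cases}$$ has a unique solution.
   Context: The equation is the non-homogeneous harmonic oscillator equation, an ordinary differential equation for a real function $y$ on $[0,\infty)$, with the constant $\mu>0$ and the function $f$ given; no initial values are prescribed. Convergence in the Riemann sense refers to convergence as improper Riemann integrals over $[0,\infty)$.
   Formalization: Solutions are in the Carathéodory sense: y' is locally absolutely continuous and the equation holds for almost every t≥0, since for discontinuous f (e.g. the indicator of {1}) no y satisfies it at every t; for continuous f these are exactly the classical solutions. *)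

theory Defs
  imports "HOL-Analysis.Analysis"
begin

text \<open>The library integral is the gauge integral. The Riemann integral is obtained by bounding
  the mesh of the tagged division uniformly instead of by a gauge; \<open>measure lborel K\<close> is the
  length of the subinterval \<open>K\<close>.\<close>

definition has_riemann_integral :: "(real \<Rightarrow> real) \<Rightarrow> real \<Rightarrow> real \<Rightarrow> real \<Rightarrow> bool" where
  "has_riemann_integral f I a b \<longleftrightarrow>
    (\<forall>\<epsilon>>0. \<exists>\<delta>>0. \<forall>p. p tagged_division_of {a..b} \<and> (\<forall>(x, K)\<in>p. measure lborel K < \<delta>) \<longrightarrow>
       \<bar>(\<Sum>(x, K)\<in>p. measure lborel K * f x) - I\<bar> < \<epsilon>)"

definition improper_riemann_convergent :: "(real \<Rightarrow> real) \<Rightarrow> real \<Rightarrow> bool" where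
  "improper_riemann_convergent f a \<longleftrightarrow>
    (\<exists>F L. (\<forall>T\<ge>a. has_riemann_integral f (F T) a T) \<and> (F \<longlongrightarrow> L) at_top)"

definition absolutely_continuous_on :: "real set \<Rightarrow> (real \<Rightarrow> real) \<Rightarrow> bool" where
  "absolutely_continuous_on S g \<longleftrightarrow>
    (\<forall>\<epsilon>>0. \<exists>\<delta>>0. \<forall>D. D division_of \<Union>D \<and> \<Union>D \<subseteq> S \<and> (\<Sum>K\<in>D. measure lborel K) < \<delta> \<longrightarrow>
       (\<Sum>K\<in>D. \<bar>g (Sup K) - g (Inf K)\<bar>) < \<epsilon>)"

text \<open>Solutions of \<open>y'' + \<mu>\<^sup>2 y = f\<close> on \<open>[0, \<infinity>)\<close> in the sense of Caratheodory. The forcing term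
  may be discontinuous, and a function with a jump has no antiderivative, so \<open>y''\<close> cannot be
  required to exist everywhere; as usual \<open>y'\<close> is locally absolutely continuous and the equation
  holds almost everywhere. The lemma \<open>oscillator_solution_iff_classical\<close> below shows that for
  continuous \<open>f\<close> these are exactly the classical solutions.\<close>

definition oscillator_solution :: "real \<Rightarrow> (real \<Rightarrow> real) \<Rightarrow> (real \<Rightarrow> real) \<Rightarrow> bool" where
  "oscillator_solution \<mu> f y \<longleftrightarrow>
    (\<exists>y'. (\<forall>t\<ge>0. (y has_real_derivative y' t) (at t within {0..})) \<and>
          (\<forall>T\<ge>0. absolutely_continuous_on {0..T} y') \<and>
          (AE t in lebesgue. t \<ge> 0 \<longrightarrow>
             (\<exists>y''. (y' has_real_derivative y'') (at t within {0..}) \<and> y'' + \<mu>\<^sup>2 * y t = f t)))"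

lemma absolutely_continuous_on_diff:
  assumes "absolutely_continuous_on S g" "absolutely_continuous_on S h"
  shows "absolutely_continuous_on S (\<lambda>x. g x - h x)"
  unfolding absolutely_continuous_on_def
proof (intro allI impI)
  fix e :: real assume "e > 0"
  then have "e/2 > 0" by simp
  obtain d1 where d1: "d1 > 0" "\<And>D. D division_of \<Union>D \<Longrightarrow> \<Union>D \<subseteq> S \<Longrightarrow> (\<Sum>K\<in>D. measure lborel K) < d1 \<Longrightarrow>
       (\<Sum>K\<in>D. \<bar>g (Sup K) - g (Inf K)\<bar>) < e/2"
    using assms(1) \<open>e/2 > 0\<close> unfolding absolutely_continuous_on_def by metis
  obtain d2 where d2: "d2 > 0" "\<And>D. D division_of \<Union>D \<Longrightarrow> \<Union>D \<subseteq> S \<Longrightarrow> (\<Sum>K\<in>D. measure lborel K) < d2 \<Longrightarrow>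
       (\<Sum>K\<in>D. \<bar>h (Sup K) - h (Inf K)\<bar>) < e/2"
    using assms(2) \<open>e/2 > 0\<close> unfolding absolutely_continuous_on_def by metis
  show "\<exists>\<delta>>0. \<forall>D. D division_of \<Union>D \<and> \<Union>D \<subseteq> S \<and> (\<Sum>K\<in>D. measure lborel K) < \<delta> \<longrightarrow>
       (\<Sum>K\<in>D. \<bar>g (Sup K) - h (Sup K) - (g (Inf K) - h (Inf K))\<bar>) < e"
  proof (intro exI[of _ "min d1 d2"] conjI allI impI)
    fix D :: "real set set"
    assume D: "D division_of \<Union>D \<and> \<Union>D \<subseteq> S \<and> (\<Sum>K\<in>D. measure lborel K) < min d1 d2"
    have "(\<Sum>K\<in>D. \<bar>g (Sup K) - h (Sup K) - (g (Inf K) - h (Inf K))\<bar>)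
        \<le> (\<Sum>K\<in>D. \<bar>g (Sup K) - g (Inf K)\<bar> + \<bar>h (Sup K) - h (Inf K)\<bar>)"
      by (rule sum_mono) linarith
    also have "\<dots> = (\<Sum>K\<in>D. \<bar>g (Sup K) - g (Inf K)\<bar>) + (\<Sum>K\<in>D. \<bar>h (Sup K) - h (Inf K)\<bar>)"
      by (rule sum.distrib)
    also have "\<dots> < e/2 + e/2"
      using D d1(2)[of D] d2(2)[of D] by (intro add_strict_mono) auto
    finally show "(\<Sum>K\<in>D. \<bar>g (Sup K) - h (Sup K) - (g (Inf K) - h (Inf K))\<bar>) < e" by simp
  qed (use d1 d2 in auto)
qed

lemma lipschitz_imp_absolutely_continuous_on:
  assumes "\<And>x y. x \<in> S \<Longrightarrow> y \<in> S \<Longrightarrow> \<bar>g x - g y\<bar> \<le> B * \<bar>x - y\<bar>"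
  shows "absolutely_continuous_on S g"
  unfolding absolutely_continuous_on_def
proof (intro allI impI)
  fix e :: real assume "e > 0"
  define C where "C = \<bar>B\<bar> + 1"
  have C: "C > 0" "B \<le> C" by (auto simp: C_def)
  show "\<exists>\<delta>>0. \<forall>D. D division_of \<Union>D \<and> \<Union>D \<subseteq> S \<and> (\<Sum>K\<in>D. measure lborel K) < \<delta> \<longrightarrow>
       (\<Sum>K\<in>D. \<bar>g (Sup K) - g (Inf K)\<bar>) < e"
  proof (intro exI[of _ "e/C"] conjI allI impI)
    fix D :: "real set set"
    assume D: "D division_of \<Union>D \<and> \<Union>D \<subseteq> S \<and> (\<Sum>K\<in>D. measure lborel K) < e/C"
    have "\<bar>g (Sup K) - g (Inf K)\<bar> \<le> C * measure lborel K" if "K \<in> D" for K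
    proof -
      have DD: "D division_of \<Union>D" using D by simp
      have "K \<noteq> {}" "\<exists>a b. K = cbox a b"
        using division_ofD(3,4)[OF DD that] by auto
      then obtain a b where K: "K = cbox a b" "K \<noteq> {}" by auto
      then have K': "K = {a..b}" "a \<le> b" by auto
      have "K \<subseteq> S" using D that by blast
      then have "\<bar>g b - g a\<bar> \<le> B * \<bar>b - a\<bar>" using K' by (intro assms) auto
      also have "\<dots> \<le> C * \<bar>b - a\<bar>" using C by (intro mult_right_mono) auto
      finally show ?thesis using K' by simp
    qed
    then have "(\<Sum>K\<in>D. \<bar>g (Sup K) - g (Inf K)\<bar>) \<le> C * (\<Sum>K\<in>D. measure lborel K)"
      by (simp add: sum_distrib_left sum_mono)
    also have "\<dots> < e" using D C by (simp add: pos_less_divide_eq mult.commute)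
    finally show "(\<Sum>K\<in>D. \<bar>g (Sup K) - g (Inf K)\<bar>) < e" .
  qed (use \<open>e > 0\<close> C in auto)
qed

lemma bounded_derivative_imp_absolutely_continuous_on:
  assumes "\<And>x. x \<in> {a..b} \<Longrightarrow> (g has_real_derivative g' x) (at x within {a..b})"
    and "continuous_on {a..b} g'"
  shows "absolutely_continuous_on {a..b} g"
proof -
  have "bounded (g' ` {a..b})"
    by (rule compact_imp_bounded[OF compact_continuous_image[OF assms(2) compact_Icc]])
  then obtain B where B: "\<And>x. x \<in> {a..b} \<Longrightarrow> norm (g' x) \<le> B"
    unfolding bounded_iff by blast
  show ?thesis
    by (rule lipschitz_imp_absolutely_continuous_on[of _ _ B])
      (use field_differentiable_bound[OF convex_real_interval(5) assms(1) B] in auto)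
qed

lemma absolutely_continuous_on_derivative_zero_AE:
  fixes k :: "real \<Rightarrow> real"
  assumes ac: "absolutely_continuous_on {a..b} k" and "a \<le> b"
    and N: "negligible N"
    and der: "\<And>x. x \<in> {a..b} - N \<Longrightarrow> (k has_real_derivative 0) (at x within {a..b})"
  shows "k b = k a"
proof -
  have "\<bar>k b - k a\<bar> \<le> e * (b - a + 1)" if "e > 0" for e
  proof -
    obtain d where d: "d > 0" "\<And>D. D division_of \<Union>D \<Longrightarrow> \<Union>D \<subseteq> {a..b} \<Longrightarrow> (\<Sum>K\<in>D. measure lborel K) < d \<Longrightarrow>
       (\<Sum>K\<in>D. \<bar>k (Sup K) - k (Inf K)\<bar>) < e"
      using ac \<open>e > 0\<close> unfolding absolutely_continuous_on_def by metis
    have N0: "N \<in> null_sets lebesgue" using N by (simp add: negligible_iff_null_sets)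
    obtain U where U0: "open U" "N \<subseteq> U" "U - N \<in> lmeasurable" "emeasure lebesgue (U - N) < ennreal d"
      using sets_lebesgue_outer_open[of N d] N0 \<open>d > 0\<close> by blast
    have "emeasure lebesgue U = emeasure lebesgue (U - N)"
      using emeasure_Diff_null_set[OF N0, of U] U0(1) by (simp add: borel_open)
    then have "emeasure lebesgue U < ennreal d" using U0 by simp
    then have U: "open U" "N \<subseteq> U" "U \<in> lmeasurable"
      using U0 order_less_trans[OF _ ennreal_less_top] by (auto intro!: fmeasurableI)
    have "measure lebesgue U < d"
      using \<open>emeasure lebesgue U < ennreal d\<close> emeasure_eq_measure2[OF U(3)] \<open>d > 0\<close>
      by (simp add: ennreal_less_iff)
    note U = U this
    have "\<exists>r>0. (x \<in> N \<longrightarrow> ball x r \<subseteq> U) \<and> (x \<in> {a..b} - N \<longrightarrow>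
            (\<forall>y\<in>{a..b}. \<bar>y - x\<bar> < r \<longrightarrow> \<bar>k y - k x\<bar> \<le> e * \<bar>y - x\<bar>))" for x
    proof (cases "x \<in> N")
      case True
      then have "x \<in> U" using U by blast
      then show ?thesis using openE[OF U(1)] True by (metis DiffD2)
    next
      case False
      show ?thesis
      proof (cases "x \<in> {a..b}")
        case True
        then have "(k has_derivative (\<lambda>h. 0)) (at x within {a..b})"
          using der[of x] False by (simp add: has_field_derivative_def lambda_zero)
        from this[unfolded has_derivative_within_alt] \<open>e > 0\<close>
        show ?thesis using False by auto
      next
        case nin: False
        then show ?thesis using False by (auto intro: exI[of _ 1])
      qed
    qed
    then obtain r where r: "\<And>x. r x > 0" "\<And>x. x \<in> N \<Longrightarrow> ball x (r x) \<subseteq> U"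
      "\<And>x y. x \<in> {a..b} - N \<Longrightarrow> y \<in> {a..b} \<Longrightarrow> \<bar>y - x\<bar> < r x \<Longrightarrow> \<bar>k y - k x\<bar> \<le> e * \<bar>y - x\<bar>"
      by metis
    have "gauge (\<lambda>x. ball x (r x))" using r(1) by (intro gauge_ball_dependent) auto
    then obtain p where p: "p tagged_division_of {a..b}" "(\<lambda>x. ball x (r x)) fine p"
      using fine_division_exists_real by blast
    have fin: "finite p" using p(1) by blast
    have box: "\<exists>u v. K = {u..v} \<and> u \<le> x \<and> x \<le> v \<and> a \<le> u \<and> v \<le> b \<and> {u..v} \<subseteq> ball x (r x)"
      if xK: "(x, K) \<in> p" for x K
    proof -
      obtain u v where "K = cbox u v" using tagged_division_ofD(4)[OF p(1) xK] by blast
      moreover have "x \<in> K" "K \<subseteq> {a..b}" using tagged_division_ofD(2,3)[OF p(1) xK] by auto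
      moreover have "K \<subseteq> ball x (r x)" using p(2) xK by (auto simp: fine_def)
      ultimately show ?thesis by auto
    qed
    define c where "c = (\<lambda>K. k (Sup K) - k (Inf K))"
    define q where "q = {(x, K) \<in> p. x \<in> N \<and> measure lborel K \<noteq> 0}"
    have tot: "(\<Sum>(x, K)\<in>p. c K) = k b - k a"
      using additive_tagged_division_1[OF \<open>a \<le> b\<close> p(1), of k] by (simp add: c_def)
    have qp: "q \<subseteq> p" by (auto simp: q_def)
    have inj: "inj_on snd q"
    proof (rule inj_onI, clarsimp)
      fix x1 x2 K assume A: "(x1, K) \<in> q" "(x2, K) \<in> q"
      show "x1 = x2"
      proof (rule ccontr)
        assume "x1 \<noteq> x2"
        then have "interior K \<inter> interior K = {}"
          using tagged_division_ofD(5)[OF p(1), of x1 K x2 K] A qp by auto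
        moreover obtain u v where "K = {u..v}" using A qp box by blast
        ultimately show False using A by (auto simp: q_def split: if_splits)
      qed
    qed
    let ?D = "snd ` q"
    have Dp: "?D division_of \<Union>?D"
    proof (rule division_ofI)
      show "finite ?D" using fin qp finite_subset by blast
    next
      fix K assume K: "K \<in> ?D"
      then obtain x where "(x, K) \<in> p" using qp by auto
      from box[OF this] show "K \<noteq> {}" "\<exists>u v. K = cbox u v" by auto
      show "K \<subseteq> \<Union>?D" using K by blast
    next
      fix K1 K2 assume "K1 \<in> ?D" "K2 \<in> ?D" "K1 \<noteq> K2"
      moreover obtain x1 x2 where "(x1, K1) \<in> p" "(x2, K2) \<in> p"
        using \<open>K1 \<in> ?D\<close> \<open>K2 \<in> ?D\<close> qp by force
      ultimately show "interior K1 \<inter> interior K2 = {}"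
        using tagged_division_ofD(5)[OF p(1)] \<open>K1 \<noteq> K2\<close> by blast
    qed simp
    have DU: "\<Union>?D \<subseteq> U"
    proof -
      have "K \<subseteq> U" if "(x, K) \<in> q" for x K
        using that box[of x K] r(2)[of x] by (auto simp: q_def)
      then show ?thesis by force
    qed
    have "(\<Sum>K\<in>?D. measure lborel K) = measure lebesgue (\<Union>?D)"
      unfolding content_division[OF Dp, symmetric]
    proof (intro sum.cong refl)
      fix K assume "K \<in> ?D"
      then obtain u v where "K = cbox u v" using division_ofD(4)[OF Dp] by blast
      then show "measure lborel K = measure lebesgue K" by simp
    qed
    also have "\<dots> \<le> measure lebesgue U"
      using DU U(3) fmeasurableD[OF lmeasurable_division[OF Dp]] by (intro measure_mono_fmeasurable)
    finally have "(\<Sum>K\<in>?D. measure lborel K) < d" using U by simp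
    moreover have "\<Union>?D \<subseteq> {a..b}"
    proof -
      have "K \<subseteq> {a..b}" if "(x, K) \<in> q" for x K
        using tagged_division_ofD(3)[OF p(1)] qp that by blast
      then show ?thesis by force
    qed
    ultimately have "(\<Sum>K\<in>?D. \<bar>c K\<bar>) < e" using d(2)[OF Dp] by (simp add: c_def)
    then have s1: "(\<Sum>(x, K)\<in>q. \<bar>c K\<bar>) < e"
      by (subst (asm) sum.reindex[OF inj]) (simp add: case_prod_unfold)
    have "\<bar>c K\<bar> \<le> e * measure lborel K" if pq: "(x, K) \<in> p - q" for x K
    proof -
      have xKp: "(x, K) \<in> p" using pq by simp
      obtain u v where K: "K = {u..v}" "u \<le> x" "x \<le> v" "a \<le> u" "v \<le> b" "{u..v} \<subseteq> ball x (r x)"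
        using box[OF xKp] by blast
      show ?thesis
      proof (cases "x \<in> N")
        case True
        then have "measure lborel K = 0" using pq by (auto simp: q_def)
        then have "u = v" using K by auto
        then show ?thesis using K by (simp add: c_def)
      next
        case False
        have "u \<in> {u..v}" "v \<in> {u..v}" using K(2,3) by auto
        then have "u \<in> ball x (r x)" "v \<in> ball x (r x)" using K(6) by blast+
        then have "\<bar>u - x\<bar> < r x" "\<bar>v - x\<bar> < r x" by (auto simp: dist_real_def)
        then have "\<bar>k u - k x\<bar> \<le> e * \<bar>u - x\<bar>" "\<bar>k v - k x\<bar> \<le> e * \<bar>v - x\<bar>"
          using r(3)[of x u] r(3)[of x v] K(2-5) False by simp_all
        moreover have "e * \<bar>u - x\<bar> + e * \<bar>v - x\<bar> = e * (v - u)"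
          using K(2,3) by (simp add: algebra_simps)
        ultimately have "\<bar>k v - k u\<bar> \<le> e * (v - u)" by linarith
        then show ?thesis using K(1-3) by (simp add: c_def)
      qed
    qed
    then have "(\<Sum>(x, K)\<in>p - q. \<bar>c K\<bar>) \<le> (\<Sum>(x, K)\<in>p - q. e * measure lborel K)"
      by (intro sum_mono) auto
    also have "\<dots> \<le> (\<Sum>(x, K)\<in>p. e * measure lborel K)"
      using fin \<open>e > 0\<close> by (intro sum_mono2) auto
    also have "\<dots> = e * (b - a)"
      using additive_content_tagged_division[of p a b] p(1) \<open>a \<le> b\<close>
      by (simp add: sum_distrib_left[symmetric] case_prod_unfold)
    finally have s2: "(\<Sum>(x, K)\<in>p - q. \<bar>c K\<bar>) \<le> e * (b - a)" .
    have "\<bar>k b - k a\<bar> \<le> (\<Sum>(x, K)\<in>p. \<bar>c K\<bar>)"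
      unfolding tot[symmetric] case_prod_unfold by (rule sum_abs)
    also have "\<dots> = (\<Sum>(x, K)\<in>p - q. \<bar>c K\<bar>) + (\<Sum>(x, K)\<in>q. \<bar>c K\<bar>)"
      by (rule sum.subset_diff[OF qp fin])
    finally show ?thesis using s1 s2 by (simp add: algebra_simps)
  qed
  note * = this
  show ?thesis
  proof (rule ccontr)
    assume "k b \<noteq> k a"
    then have pos: "\<bar>k b - k a\<bar> > 0" "b - a + 1 > 0" using \<open>a \<le> b\<close> by simp_all
    then have "\<bar>k b - k a\<bar> \<le> \<bar>k b - k a\<bar> / (2 * (b - a + 1)) * (b - a + 1)"
      by (intro *) simp
    also have "\<dots> = \<bar>k b - k a\<bar> / 2"
    proof -
      have "c / (2 * d) * d = c / 2" if "d > 0" for c d :: real using that by simp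
      then show ?thesis using pos(2) by blast
    qed
    finally show False using pos(1) by simp
  qed
qed

lemma oscillator_solution_iff_classical:
  assumes f: "continuous_on {0..} f"
  shows "oscillator_solution \<mu> f y \<longleftrightarrow>
    (\<exists>y' y''. \<forall>t\<ge>0. (y has_real_derivative y' t) (at t within {0..}) \<and>
                    (y' has_real_derivative y'' t) (at t within {0..}) \<and>
                    y'' t + \<mu>\<^sup>2 * y t = f t)"
    (is "?C \<longleftrightarrow> ?K")
proof
  assume ?K
  then obtain y' y'' where y: "\<And>t. t \<ge> 0 \<Longrightarrow> (y has_real_derivative y' t) (at t within {0..})"
    "\<And>t. t \<ge> 0 \<Longrightarrow> (y' has_real_derivative y'' t) (at t within {0..})"
    "\<And>t. t \<ge> 0 \<Longrightarrow> y'' t + \<mu>\<^sup>2 * y t = f t" by auto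
  have "continuous_on {0..} y" unfolding continuous_on_eq_continuous_within
    by (intro ballI DERIV_continuous[OF y(1)]) auto
  then have "continuous_on {0..} (\<lambda>t. f t - \<mu>\<^sup>2 * y t)" by (intro continuous_intros f)
  then have c: "continuous_on {0..} y''"
    by (rule continuous_on_eq) (use y(3) in \<open>auto simp: algebra_simps\<close>)
  have "absolutely_continuous_on {0..T} y'" for T
    by (rule bounded_derivative_imp_absolutely_continuous_on[of _ _ _ y''])
      (use c in \<open>auto intro: DERIV_subset[OF y(2)] continuous_on_subset\<close>)
  then show ?C unfolding oscillator_solution_def
    by (intro exI[of _ y'] conjI allI impI AE_I2) (use y in blast)+
next
  assume ?C
  then obtain y' where y: "\<And>t. t \<ge> 0 \<Longrightarrow> (y has_real_derivative y' t) (at t within {0..})"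
    and ac: "\<And>T. T \<ge> 0 \<Longrightarrow> absolutely_continuous_on {0..T} y'"
    and ae: "AE t in lebesgue. t \<ge> 0 \<longrightarrow>
             (\<exists>y''. (y' has_real_derivative y'') (at t within {0..}) \<and> y'' + \<mu>\<^sup>2 * y t = f t)"
    unfolding oscillator_solution_def by blast
  define g where "g = (\<lambda>t. f t - \<mu>\<^sup>2 * y t)"
  have "continuous_on {0..} y" unfolding continuous_on_eq_continuous_within
    by (intro ballI DERIV_continuous[OF y]) auto
  then have g: "continuous_on {0..} g" unfolding g_def by (intro continuous_intros f)
  obtain N where N: "negligible N" "\<And>t. t \<ge> 0 \<Longrightarrow> t \<notin> N \<Longrightarrow> (y' has_real_derivative g t) (at t within {0..})"
  proof -
    have "AE t in lebesgue. t \<ge> 0 \<longrightarrow> (y' has_real_derivative g t) (at t within {0..})"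
      using ae by eventually_elim (metis add_diff_cancel_right' g_def)
    then obtain N where "{t. \<not> (t \<ge> 0 \<longrightarrow> (y' has_real_derivative g t) (at t within {0..}))} \<subseteq> N"
        "N \<in> null_sets lebesgue"
      by (auto elim!: AE_E simp: null_sets_def)
    then show ?thesis by (intro that[of N]) (auto simp: negligible_iff_null_sets)
  qed
  define G where "G = (\<lambda>t. integral {0..t} g)"
  have G: "(G has_real_derivative g t) (at t within {0..T})" if "t \<in> {0..T}" for t T
    unfolding G_def has_real_derivative_iff_has_vector_derivative
    by (rule integral_has_vector_derivative) (use that in \<open>auto intro: continuous_on_subset[OF g]\<close>)
  have eq: "y' t = y' 0 + G t" if "t \<ge> 0" for t
  proof -
    have "absolutely_continuous_on {0..t} G"
      by (rule bounded_derivative_imp_absolutely_continuous_on[of _ _ _ g])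
        (use G in \<open>auto intro: continuous_on_subset[OF g]\<close>)
    then have "absolutely_continuous_on {0..t} (\<lambda>x. y' x - G x)"
      using ac[OF that] by (rule absolutely_continuous_on_diff[rotated])
    then have "y' t - G t = y' 0 - G 0"
    proof (rule absolutely_continuous_on_derivative_zero_AE[OF _ that N(1)])
      fix x assume x: "x \<in> {0..t} - N"
      then have "(y' has_real_derivative g x) (at x within {0..t})"
        by (intro DERIV_subset[OF N(2)[of x]]) auto
      then show "((\<lambda>x. y' x - G x) has_real_derivative 0) (at x within {0..t})"
        using DERIV_diff[OF _ G[of x t], of y' "g x"] x by simp
    qed
    then show ?thesis by (simp add: G_def)
  qed
  have "(y' has_real_derivative g t) (at t within {0..})" if "t \<ge> 0" for t
  proof -
    have "at t within {0..} = at t within {0..t+1}"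
      by (rule at_within_nhd[of _ "{..<t+1}"]) auto
    then have "(G has_real_derivative g t) (at t within {0..})" using G[of t "t+1"] that by simp
    then have "((\<lambda>t. y' 0 + G t) has_real_derivative g t) (at t within {0..})"
      by (auto intro!: derivative_eq_intros)
    then show ?thesis
      proof (rule has_field_derivative_transform_within[of _ _ _ _ 1])
      show "y' 0 + G x = y' x" if "x \<in> {0..}" for x using eq[of x] that by simp
    qed (use that in auto)
  qed
  then show ?K
    by (intro exI[of _ y'] exI[of _ g]) (use y in \<open>auto simp: g_def\<close>)
qed

end

theory Submission
  imports Defs
begin

text \<open>Suppose that \<open>s\<close> and \<open>c\<close> are primitives of \<open>sin (\<mu> t) f t\<close> and \<open>cos (\<mu> t) f t\<close>. Variation of
  constants suggests the solution
  \<open>y t = (sin (\<mu> t) c t - cos (\<mu> t) s t) / \<mu>\<close>. Convergence of the two improper integrals says exactly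
  that the primitives can be normalised to tend to zero at infinity, and then \<open>y\<close> tends to zero,
  since sine and cosine are bounded. Two solutions that tend to zero differ by a decaying solution
  of the homogeneous equation; such a solution is periodic, hence zero.

  The analytic content lies in the weak regularity of \<open>f\<close>. A Riemann integrable function is bounded
  and gauge integrable, so its primitive is locally Lipschitz and has the expected derivative
  almost everywhere (\<open>improper_riemann_convergent_primitive\<close>). Formally the derivative of \<open>y\<close> is
  the continuous function \<open>cos (\<mu> t) c t + sin (\<mu> t) s t\<close>, but the computation is justified only
  almost everywhere. Since \<open>y\<close> is locally Lipschitz, it is the integral of its almost everywhere
  derivative, and continuity of the latter gives differentiability everywhere
  (\<open>has_real_derivative_everywhere_if_AE_continuous\<close>,
  \<open>oscillator_solution_variation_of_constants\<close>). In the proof of uniqueness the right-hand side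
  of the homogeneous equation is continuous, so its solutions are classical
  (\<open>homogeneous_oscillator_decaying_eq_0\<close>).\<close>

section \<open>Riemann integrable functions and their primitives\<close>

text \<open>A subinterval inside a ball of radius \<open>d/3\<close> has length at most \<open>2d/3\<close>. So a constant gauge
  controls the mesh, which turns the uniform bound in the definition of the Riemann integral into
  fineness for a gauge.\<close>

lemma fine_ball_imp_mesh_less:
  fixes a b d :: real
  assumes p: "p tagged_division_of {a..b}" "(\<lambda>x. ball x (d/3)) fine p" and xK: "(x, K) \<in> p"
  shows "measure lborel K < d"
proof -
  obtain u v where K: "K = {u..v}" using tagged_division_ofD(4)[OF p(1) xK] by auto
  moreover have "x \<in> K" "K \<subseteq> ball x (d/3)"
    using tagged_division_ofD(2)[OF p(1) xK] fineD[OF p(2) xK] by auto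
  ultimately have "u \<in> ball x (d/3)" "v \<in> ball x (d/3)" "u \<le> v"
    by (auto simp: subset_iff)
  then have "v - u < d" unfolding mem_ball dist_real_def by linarith
  then show ?thesis using K \<open>u \<le> v\<close> by simp
qed

lemma has_riemann_integral_imp_has_integral:
  assumes "has_riemann_integral f I a b"
  shows "(f has_integral I) {a..b}"
  unfolding has_integral_real
proof (intro allI impI)
  fix e :: real assume "e > 0"
  then obtain d where d: "d > 0"
    "\<And>p. p tagged_division_of {a..b} \<Longrightarrow> \<forall>(x, K)\<in>p. measure lborel K < d \<Longrightarrow>
       \<bar>(\<Sum>(x, K)\<in>p. measure lborel K * f x) - I\<bar> < e"
    using assms unfolding has_riemann_integral_def by metis
  show "\<exists>\<gamma>. gauge \<gamma> \<and> (\<forall>\<D>. \<D> tagged_division_of {a..b} \<and> \<gamma> fine \<D> \<longrightarrow>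
      norm ((\<Sum>(x, k)\<in>\<D>. measure lborel k *\<^sub>R f x) - I) < e)"
    using d fine_ball_imp_mesh_less[of _ a b d]
    by (intro exI[of _ "\<lambda>x. ball x (d/3)"]) (fastforce simp: gauge_ball)
qed

text \<open>Fix one tagged division of small mesh and move a single tag, that of the subinterval \<open>K\<close>, from
  \<open>t\<close> to an arbitrary point \<open>x\<close> of \<open>K\<close>. Both Riemann sums lie within \<open>1\<close> of the integral, so they
  differ by less than \<open>2\<close>; but they differ by \<open>\<bar>K\<bar> (f x - f t)\<close>. Hence \<open>f\<close> is bounded on each of the
  finitely many subintervals.\<close>

lemma has_riemann_integral_imp_bounded:
  assumes "has_riemann_integral f I a b"
  shows "bounded (f ` {a..b})"
proof -
  obtain d where d: "d > 0"
    "\<And>p. p tagged_division_of {a..b} \<Longrightarrow> \<forall>(x, K)\<in>p. measure lborel K < d \<Longrightarrow>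
       \<bar>(\<Sum>(x, K)\<in>p. measure lborel K * f x) - I\<bar> < 1"
    using assms zero_less_one unfolding has_riemann_integral_def by metis
  have "gauge (\<lambda>x::real. ball x (d/3))" using d by (simp add: gauge_ball)
  then obtain p where p: "p tagged_division_of {a..b}" "(\<lambda>x. ball x (d/3)) fine p"
    using fine_division_exists_real by blast
  note mesh = fine_ball_imp_mesh_less[OF p]
  have fin: "finite p" using p(1) by blast
  \<comment> \<open>Degenerate subintervals contribute \<open>2 / 0 = 0\<close> here: their only point is
    the tag, at which the first summand bounds \<open>f\<close>.\<close>
  define B where "B = (\<Sum>(t, K)\<in>p. \<bar>f t\<bar> + 2 / measure lborel K)"
  have "\<bar>f x\<bar> \<le> B" if x: "x \<in> {a..b}" for x
  proof -
    obtain t K where tK: "(t, K) \<in> p" "x \<in> K"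
      using tagged_division_ofD(6)[OF p(1)] x by blast
    have "\<bar>f x\<bar> \<le> \<bar>f t\<bar> + 2 / measure lborel K"
    proof (cases "x = t")
      case False
      obtain u v where K: "K = {u..v}" using tagged_division_ofD(4)[OF p(1) tK(1)] by auto
      have "t \<in> K" using tagged_division_ofD(2)[OF p(1) tK(1)] .
      with K False tK(2) have "u < v" by auto
      then have pos: "measure lborel K > 0" using K by simp
      define r where "r = p - {(t, K)}"
      have new: "(x, K) \<notin> p"
      proof
        assume "(x, K) \<in> p"
        then have "interior K \<inter> interior K = {}"
          using tagged_division_ofD(5)[OF p(1) tK(1), of x K] False by auto
        then show False using K \<open>u < v\<close> by simp
      qed
      have "insert (x, K) r tagged_division_of {a..b}"
      proof (rule tagged_division_ofI)
        fix x1 K1 x2 K2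
        assume A: "(x1, K1) \<in> insert (x, K) r" "(x2, K2) \<in> insert (x, K) r" "(x1, K1) \<noteq> (x2, K2)"
        then show "interior K1 \<inter> interior K2 = {}"
          using tagged_division_ofD(5)[OF p(1)] tK(1) unfolding r_def by blast
      next
        show "\<Union>{L. \<exists>s. (s, L) \<in> insert (x, K) r} = {a..b}"
          unfolding r_def tagged_division_ofD(6)[OF p(1), symmetric] using tK(1) by blast
      next
        show "finite (insert (x, K) r)" using fin by (simp add: r_def)
      next
        fix s L assume "(s, L) \<in> insert (x, K) r"
        then have "s \<in> L \<and> (\<exists>t. (t, L) \<in> p)"
          using tK tagged_division_ofD(2)[OF p(1)] by (auto simp: r_def)
        then show "s \<in> L" "L \<subseteq> {a..b}" "\<exists>u v. L = cbox u v"
          using tagged_division_ofD(3,4)[OF p(1)] by blast+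
      qed
      then have "\<bar>(\<Sum>(s, L)\<in>insert (x, K) r. measure lborel L * f s) - I\<bar> < 1"
        by (rule d(2)) (use mesh tK in \<open>auto simp: r_def\<close>)
      then have "\<bar>measure lborel K * f x + (\<Sum>(s, L)\<in>r. measure lborel L * f s) - I\<bar> < 1"
        using fin new by (simp add: r_def)
      moreover have "\<bar>(\<Sum>(s, L)\<in>p. measure lborel L * f s) - I\<bar> < 1"
        using p mesh by (intro d(2)) auto
      then have "\<bar>measure lborel K * f t + (\<Sum>(s, L)\<in>r. measure lborel L * f s) - I\<bar> < 1"
        using sum.remove[OF fin tK(1), of "\<lambda>(s, L). measure lborel L * f s"] by (simp add: r_def)
      ultimately have "\<bar>measure lborel K * f x - measure lborel K * f t\<bar> < 2"
        by linarith
      then have "measure lborel K * \<bar>f x - f t\<bar> < 2"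
        using pos by (simp add: right_diff_distrib[symmetric] abs_mult)
      then have "\<bar>f x - f t\<bar> < 2 / measure lborel K" using pos by (simp add: field_simps)
      then show ?thesis by linarith
    qed simp
    also have "\<dots> \<le> B"
      unfolding B_def
      using member_le_sum[OF tK(1), of "\<lambda>(t, K). \<bar>f t\<bar> + 2 / measure lborel K"] fin by auto
    finally show ?thesis .
  qed
  then show ?thesis unfolding bounded_iff by (intro exI[of _ B]) auto
qed

text \<open>Lebesgue's differentiation theorem on the line. The library result
  \<open>integrable_ccontinuous_explicit\<close> yields the right-hand difference quotients at almost every
  point. Applied to the reflected function \<open>\<lambda>x. g (- x)\<close>, it yields the left-hand ones.\<close>

lemma indefinite_integral_has_derivative_AE:
  fixes g :: "real \<Rightarrow> real"
  assumes int: "\<And>a b. g integrable_on {a..b}"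
  obtains N where "negligible N"
    "\<And>a x. x \<notin> N \<Longrightarrow> a < x \<Longrightarrow> ((\<lambda>t. integral {a..t} g) has_real_derivative g x) (at x)"
proof -
  obtain N1 where N1: "negligible N1"
    "\<And>x e. \<lbrakk>x \<notin> N1; 0 < e\<rbrakk> \<Longrightarrow>
       \<exists>d>0. \<forall>h. 0 < h \<and> h < d \<longrightarrow> \<bar>integral {x..x + h} g / h - g x\<bar> < e"
    using integrable_ccontinuous_explicit[of g] int by (auto simp: divide_inverse_commute)
  have "(\<lambda>x. g (- x)) integrable_on {a..b}" for a b
    using int[of "-b" "-a"] Henstock_Kurzweil_Integration.integrable_reflect_real[of g "-a" "-b"] by simp
  then obtain N2 where N2: "negligible N2"
    "\<And>x e. \<lbrakk>x \<notin> N2; 0 < e\<rbrakk> \<Longrightarrow>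
       \<exists>d>0. \<forall>h. 0 < h \<and> h < d \<longrightarrow> \<bar>integral {x..x + h} (\<lambda>x. g (- x)) / h - g (- x)\<bar> < e"
    using integrable_ccontinuous_explicit[of "\<lambda>x. g (- x)"] by (auto simp: divide_inverse_commute)
  show ?thesis
  proof
    have "negligible (uminus ` N2)"
      by (rule negligible_differentiable_image_negligible[OF _ N2(1)])
        (auto intro!: derivative_intros)
    then show "negligible (N1 \<union> uminus ` N2)" using N1(1) by simp
  next
    fix a x assume x: "x \<notin> N1 \<union> uminus ` N2" and "a < x"
    have "- x \<notin> N2" using x by (metis UnI2 image_eqI minus_minus)
    show "((\<lambda>t. integral {a..t} g) has_real_derivative g x) (at x)"
      unfolding DERIV_def LIM_eq
    proof (intro allI impI)
      fix e :: real assume "e > 0"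
      obtain d1 where d1: "d1 > 0" "\<And>h. 0 < h \<Longrightarrow> h < d1 \<Longrightarrow> \<bar>integral {x..x + h} g / h - g x\<bar> < e"
        using N1(2)[of x e] x \<open>e > 0\<close> by auto
      obtain d2 where d2: "d2 > 0"
        "\<And>h. 0 < h \<Longrightarrow> h < d2 \<Longrightarrow> \<bar>integral {- x..- x + h} (\<lambda>x. g (- x)) / h - g x\<bar> < e"
        using N2(2)[of "- x" e] \<open>- x \<notin> N2\<close> \<open>e > 0\<close> by auto
      have "\<bar>(integral {a..x + h} g - integral {a..x} g) / h - g x\<bar> < e"
        if h: "h \<noteq> 0" "\<bar>h\<bar> < min (min d1 d2) (x - a)" for h
      proof (cases "h > 0")
        case True
        have "integral {a..x} g + integral {x..x + h} g = integral {a..x + h} g"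
          using True \<open>a < x\<close> by (intro Henstock_Kurzweil_Integration.integral_combine int) auto
        then have "integral {a..x + h} g - integral {a..x} g = integral {x..x + h} g" by linarith
        then show ?thesis using d1(2)[of h] True h by simp
      next
        case False
        have "integral {a..x + h} g + integral {x + h..x} g = integral {a..x} g"
          using False h by (intro Henstock_Kurzweil_Integration.integral_combine int) auto
        moreover have "integral {- x..- x + (- h)} (\<lambda>x. g (- x)) = integral {x + h..x} g"
          using Henstock_Kurzweil_Integration.integral_reflect_real[of x "x + h" g] by simp
        ultimately have "integral {a..x + h} g - integral {a..x} g =
            - integral {- x..- x + (- h)} (\<lambda>x. g (- x))" by linarith
        then have "integral {- x..- x + (- h)} (\<lambda>x. g (- x)) / (- h) =
            (integral {a..x + h} g - integral {a..x} g) / h" by simp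
        then show ?thesis using d2(2)[of "- h"] False h by auto
      qed
      then show "\<exists>s>0. \<forall>h. h \<noteq> 0 \<and> norm (h - 0) < s \<longrightarrow>
          norm ((integral {a..x + h} g - integral {a..x} g) / h - g x) < e"
        using d1(1) d2(1) \<open>a < x\<close> by (intro exI[of _ "min (min d1 d2) (x - a)"]) auto
    qed
  qed
qed

text \<open>The function \<open>G\<close> is minus the tail \<open>\<integral>\<^sub>t\<^sup>\<infinity> g\<close> of the convergent integral, normalised to vanish at
  infinity. It is Lipschitz on bounded intervals because Riemann integrable functions are bounded.
  These properties of the two integrals in the hypothesis are all that the construction of a
  decaying solution uses.\<close>

lemma improper_riemann_convergent_primitive:
  assumes "improper_riemann_convergent g 0"
  obtains G N where "(G \<longlongrightarrow> 0) at_top"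
    "\<And>T. \<exists>B. B-lipschitz_on {0..T} G"
    "negligible N"
    "\<And>t. t \<ge> 0 \<Longrightarrow> t \<notin> N \<Longrightarrow> (G has_real_derivative g t) (at t within {0..})"
proof -
  obtain F L where F: "\<And>T. T \<ge> 0 \<Longrightarrow> has_riemann_integral g (F T) 0 T" "(F \<longlongrightarrow> L) at_top"
    using assms unfolding improper_riemann_convergent_def by blast
  have int: "g integrable_on {a..b}" if "0 \<le> a" for a b
  proof (rule integrable_on_subinterval[of _ "{0..max 0 b}"])
    show "g integrable_on {0..max 0 b}"
      using has_riemann_integral_imp_has_integral[OF F(1)[of "max 0 b"]] by auto
  qed (use that in auto)
  have Feq: "integral {0..t} g = F t" if "t \<ge> 0" for t
    using has_riemann_integral_imp_has_integral[OF F(1)[OF that]] by (rule integral_unique)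
  define G where "G t = integral {0..t} g - L" for t
  \<comment> \<open>Extension by zero, since the differentiation theorem concerns functions on the whole line.
    At \<open>0\<close> the extension may jump, so \<open>0\<close> joins the exceptional set.\<close>
  define h where "h = (\<lambda>t. if t \<in> {0..} then g t else 0)"
  have "h integrable_on {a..b}" for a b
  proof -
    have "{0..} \<inter> {a..b} = {max 0 a..b}" by auto
    then show ?thesis unfolding h_def integrable_restrict_Int using int[of "max 0 a" b] by simp
  qed
  then obtain N where N: "negligible N"
    "\<And>a x. x \<notin> N \<Longrightarrow> a < x \<Longrightarrow> ((\<lambda>t. integral {a..t} h) has_real_derivative h x) (at x)"
    using indefinite_integral_has_derivative_AE by blast
  show ?thesis
  proof
    have "((\<lambda>t. F t - L) \<longlongrightarrow> L - L) at_top" by (intro tendsto_intros F)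
    moreover have "eventually (\<lambda>t. F t - L = G t) at_top"
      using eventually_ge_at_top[of 0] by eventually_elim (simp add: G_def Feq)
    ultimately show "(G \<longlongrightarrow> 0) at_top" by (simp add: tendsto_cong)
  next
    fix T :: real
    have "bounded (g ` {0..max 0 T})" by (rule has_riemann_integral_imp_bounded[OF F(1)]) simp
    then obtain B where B: "\<And>x. x \<in> {0..max 0 T} \<Longrightarrow> \<bar>g x\<bar> \<le> B"
      unfolding bounded_iff by (metis imageI real_norm_def)
    have "B \<ge> 0" using B[of 0] by simp
    have *: "\<bar>G y - G x\<bar> \<le> B * (y - x)" if "0 \<le> x" "x \<le> y" "y \<le> T" for x y
    proof -
      have "integral {0..x} g + integral {x..y} g = integral {0..y} g"
        using that by (intro Henstock_Kurzweil_Integration.integral_combine int) auto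
      then have "\<bar>G y - G x\<bar> = \<bar>integral {x..y} g\<bar>" by (simp add: G_def)
      also have "\<dots> \<le> B * (y - x)"
        using has_integral_bound_real[OF \<open>B \<ge> 0\<close>, of "{}" g "integral {x..y} g" x y] that B
          int[of x y] by (auto simp: integrable_integral)
      finally show ?thesis .
    qed
    have "B-lipschitz_on {0..T} G"
    proof (rule lipschitz_onI)
      fix x y assume "x \<in> {0..T}" "y \<in> {0..T}"
      then show "dist (G x) (G y) \<le> B * dist x y"
        using *[of x y] *[of y x] by (cases "x \<le> y") (auto simp: dist_real_def abs_minus_commute)
    qed fact
    then show "\<exists>B. B-lipschitz_on {0..T} G" ..
  next
    show "negligible (insert 0 N)" using N by simp
  next
    fix t :: real assume t: "t \<ge> 0" "t \<notin> insert 0 N"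
    have "((\<lambda>x. integral {0..x} h - L) has_real_derivative h t) (at t)"
      using N(2)[of t 0] t by (auto intro!: derivative_eq_intros)
    then have "((\<lambda>x. integral {0..x} h - L) has_real_derivative h t) (at t within {0..})"
      by (rule has_field_derivative_at_within)
    moreover have "integral {0..x} h = integral {0..x} g" for x
      by (rule Henstock_Kurzweil_Integration.integral_cong) (simp add: h_def)
    ultimately show "(G has_real_derivative g t) (at t within {0..})"
      using t by (simp add: G_def[abs_def] h_def)
  qed
qed

section \<open>Lipschitz and absolutely continuous functions\<close>

lemma lipschitz_on_mult:
  fixes f g :: "'a::metric_space \<Rightarrow> real"
  assumes f: "C-lipschitz_on S f" and g: "D-lipschitz_on S g"
    and M: "\<And>x. x \<in> S \<Longrightarrow> \<bar>f x\<bar> \<le> M" and N: "\<And>x. x \<in> S \<Longrightarrow> \<bar>g x\<bar> \<le> N"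
    and "0 \<le> M" "0 \<le> N"
  shows "(C * N + M * D)-lipschitz_on S (\<lambda>x. f x * g x)"
proof (rule lipschitz_onI)
  fix x y assume xy: "x \<in> S" "y \<in> S"
  have "\<bar>f x * g x - f y * g y\<bar> = \<bar>(f x - f y) * g x + f y * (g x - g y)\<bar>"
    by (simp add: algebra_simps)
  also have "\<dots> \<le> \<bar>f x - f y\<bar> * \<bar>g x\<bar> + \<bar>f y\<bar> * \<bar>g x - g y\<bar>"
    by (metis abs_mult abs_triangle_ineq)
  also have "\<dots> \<le> (C * dist x y) * N + M * (D * dist x y)"
    using lipschitz_onD[OF f xy] lipschitz_onD[OF g xy] M[OF xy(2)] N[OF xy(1)] assms(5,6)
      lipschitz_on_nonneg[OF f]
    by (intro add_mono mult_mono) (auto simp: dist_real_def)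
  finally show "dist (f x * g x) (f y * g y) \<le> (C * N + M * D) * dist x y"
    by (simp add: dist_real_def algebra_simps)
qed (use assms lipschitz_on_nonneg[OF f] lipschitz_on_nonneg[OF g] in auto)

lemma lipschitz_on_sin: "\<bar>\<mu>\<bar>-lipschitz_on S (\<lambda>t::real. sin (\<mu> * t))"
  and lipschitz_on_cos: "\<bar>\<mu>\<bar>-lipschitz_on S (\<lambda>t::real. cos (\<mu> * t))"
proof -
  have "norm (sin (\<mu> * x) - sin (\<mu> * y)) \<le> \<bar>\<mu>\<bar> * norm (x - y)" for x y :: real
    by (rule field_differentiable_bound[where S = UNIV and f' = "\<lambda>t. \<mu> * cos (\<mu> * t)"])
      (auto intro!: derivative_eq_intros simp: abs_mult mult_left_le)
  then show "\<bar>\<mu>\<bar>-lipschitz_on S (\<lambda>t::real. sin (\<mu> * t))"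
    by (intro lipschitz_onI) (auto simp: dist_real_def)
  have "norm (cos (\<mu> * x) - cos (\<mu> * y)) \<le> \<bar>\<mu>\<bar> * norm (x - y)" for x y :: real
    by (rule field_differentiable_bound[where S = UNIV and f' = "\<lambda>t. - \<mu> * sin (\<mu> * t)"])
      (auto intro!: derivative_eq_intros simp: abs_mult mult_left_le)
  then show "\<bar>\<mu>\<bar>-lipschitz_on S (\<lambda>t::real. cos (\<mu> * t))"
    by (intro lipschitz_onI) (auto simp: dist_real_def)
qed

lemma lipschitz_on_bounded_mult_Icc:
  fixes h G :: "real \<Rightarrow> real"
  assumes h: "C-lipschitz_on {a..b} h" "\<And>x. \<bar>h x\<bar> \<le> 1" and G: "\<exists>B. B-lipschitz_on {a..b} G"
  shows "\<exists>B. B-lipschitz_on {a..b} (\<lambda>x. h x * G x)"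
proof -
  obtain B where B: "B-lipschitz_on {a..b} G" using G by blast
  have "bounded (G ` {a..b})"
    using compact_continuous_image[OF lipschitz_on_continuous_on[OF B] compact_Icc]
    by (rule compact_imp_bounded)
  then obtain N where N: "N > 0" "\<And>x. x \<in> {a..b} \<Longrightarrow> \<bar>G x\<bar> \<le> N"
    unfolding bounded_pos by (metis imageI real_norm_def)
  have "(C * N + 1 * B)-lipschitz_on {a..b} (\<lambda>x. h x * G x)"
    using N h by (intro lipschitz_on_mult B) auto
  then show ?thesis ..
qed

lemma lipschitz_on_imp_absolutely_continuous_on:
  "B-lipschitz_on S g \<Longrightarrow> absolutely_continuous_on S g"
  using lipschitz_onD by (intro lipschitz_imp_absolutely_continuous_on) (force simp: dist_real_def)

text \<open>The function \<open>y\<close> minus the indefinite integral of \<open>p\<close> is absolutely continuous with derivative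
  zero almost everywhere, hence constant. So \<open>y\<close> inherits differentiability at every point from the
  integral of the continuous function \<open>p\<close>.\<close>

lemma has_real_derivative_everywhere_if_AE_continuous:
  fixes y p :: "real \<Rightarrow> real"
  assumes ac: "\<And>T. absolutely_continuous_on {0..T} y" and p: "continuous_on {0..} p"
    and N: "negligible N"
    and der: "\<And>t. t \<ge> 0 \<Longrightarrow> t \<notin> N \<Longrightarrow> (y has_real_derivative p t) (at t within {0..})"
    and "t \<ge> 0"
  shows "(y has_real_derivative p t) (at t within {0..})"
proof -
  define P where "P = (\<lambda>t. integral {0..t} p)"
  have P: "(P has_real_derivative p t) (at t within {0..T})" if "t \<in> {0..T}" for t T
    unfolding P_def has_real_derivative_iff_has_vector_derivative
    by (rule integral_has_vector_derivative) (use that in \<open>auto intro: continuous_on_subset[OF p]\<close>)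
  have eq: "y 0 + P t = y t" if "t \<ge> 0" for t
  proof -
    have "absolutely_continuous_on {0..t} P"
      by (rule bounded_derivative_imp_absolutely_continuous_on[of _ _ _ p])
        (use P in \<open>auto intro: continuous_on_subset[OF p]\<close>)
    then have "absolutely_continuous_on {0..t} (\<lambda>x. y x - P x)"
      using ac by (rule absolutely_continuous_on_diff[rotated])
    then have "y t - P t = y 0 - P 0"
    proof (rule absolutely_continuous_on_derivative_zero_AE[OF _ that N])
      fix x assume x: "x \<in> {0..t} - N"
      then have "(y has_real_derivative p x) (at x within {0..t})"
        by (intro DERIV_subset[OF der]) auto
      then show "((\<lambda>x. y x - P x) has_real_derivative 0) (at x within {0..t})"
        using DERIV_diff[OF _ P[of x t], of y "p x"] x by simp
    qed
    then show ?thesis by (simp add: P_def)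
  qed
  have "at t within {0..} = at t within {0..t + 1}"
    by (rule at_within_nhd[of _ "{..<t + 1}"]) auto
  then have "((\<lambda>t. y 0 + P t) has_real_derivative p t) (at t within {0..})"
    using P[of t "t + 1"] \<open>t \<ge> 0\<close> by (auto intro!: derivative_eq_intros)
  then show ?thesis
    by (rule has_field_derivative_transform_within[of _ _ _ _ 1]) (use eq \<open>t \<ge> 0\<close> in auto)
qed

section \<open>The oscillator equation\<close>

text \<open>Variation of constants. Where \<open>s\<close> and \<open>c\<close> are differentiable, the terms containing \<open>f\<close> cancel in
  the derivative of the candidate \<open>y\<close>, leaving the continuous function
  \<open>p t = cos (\<mu> t) c t + sin (\<mu> t) s t\<close>; by the preceding lemma \<open>p\<close> is then the derivative of \<open>y\<close>
  at every point, even where \<open>s\<close> and \<open>c\<close> are not differentiable. Differentiating \<open>p\<close>, the terms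
  containing \<open>f\<close> add up to \<open>(cos\<^sup>2 + sin\<^sup>2) f = f\<close>.\<close>

lemma oscillator_solution_variation_of_constants:
  assumes "\<mu> \<noteq> 0" and "negligible N"
    and s_lip: "\<And>T. \<exists>B. B-lipschitz_on {0..T} s" and c_lip: "\<And>T. \<exists>B. B-lipschitz_on {0..T} c"
    and s': "\<And>t. t \<ge> 0 \<Longrightarrow> t \<notin> N \<Longrightarrow> (s has_real_derivative sin (\<mu> * t) * f t) (at t within {0..})"
    and c': "\<And>t. t \<ge> 0 \<Longrightarrow> t \<notin> N \<Longrightarrow> (c has_real_derivative cos (\<mu> * t) * f t) (at t within {0..})"
  shows "oscillator_solution \<mu> f (\<lambda>t. (sin (\<mu> * t) * c t - cos (\<mu> * t) * s t) / \<mu>)"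
    (is "oscillator_solution \<mu> f ?y")
proof -
  define p where "p t = cos (\<mu> * t) * c t + sin (\<mu> * t) * s t" for t
  have sin_lip: "\<exists>B. B-lipschitz_on {0..T} (\<lambda>t. sin (\<mu> * t) * g t)"
    and cos_lip: "\<exists>B. B-lipschitz_on {0..T} (\<lambda>t. cos (\<mu> * t) * g t)"
    if "\<And>T. \<exists>B. B-lipschitz_on {0..T} g" for g :: "real \<Rightarrow> real" and T
    using lipschitz_on_bounded_mult_Icc[OF lipschitz_on_sin _ that]
      lipschitz_on_bounded_mult_Icc[OF lipschitz_on_cos _ that] by auto
  have p_lip: "\<exists>B. B-lipschitz_on {0..T} p" for T
    unfolding p_def using lipschitz_on_add cos_lip[OF c_lip] sin_lip[OF s_lip] by blast
  have y_lip: "\<exists>B. B-lipschitz_on {0..T} ?y" for T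
  proof -
    have "\<exists>B. B-lipschitz_on {0..T} (\<lambda>t. sin (\<mu> * t) * c t - cos (\<mu> * t) * s t)"
      using lipschitz_on_diff cos_lip[OF s_lip] sin_lip[OF c_lip] by blast
    then show ?thesis
      using lipschitz_on_cmult_real[of _ _ _ "1 / \<mu>"] by (auto simp: divide_inverse_commute)
  qed
  have p_cont: "continuous_on {0..} p"
  proof -
    have "continuous (at t within {0..}) p" if "t \<ge> 0" for t
    proof -
      have "at t within {0..} = at t within {0..t + 1}"
        by (rule at_within_nhd[of _ "{..<t + 1}"]) auto
      moreover have "continuous_on {0..t + 1} p"
        using p_lip[of "t + 1"] lipschitz_on_continuous_on by blast
      ultimately show ?thesis using that by (simp add: continuous_on_eq_continuous_within)
    qed
    then show ?thesis by (simp add: continuous_on_eq_continuous_within)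
  qed
  have y': "(?y has_real_derivative p t) (at t within {0..})" if "t \<ge> 0" for t
  proof (rule has_real_derivative_everywhere_if_AE_continuous[OF _ p_cont \<open>negligible N\<close> _ that])
    show "absolutely_continuous_on {0..T} ?y" for T
      using y_lip lipschitz_on_imp_absolutely_continuous_on by blast
    fix t :: real assume t: "t \<ge> 0" "t \<notin> N"
    show "(?y has_real_derivative p t) (at t within {0..})"
      using \<open>\<mu> \<noteq> 0\<close>
      by (auto intro!: derivative_eq_intros s'[OF t] c'[OF t] simp: p_def algebra_simps)
        (simp add: field_simps)
  qed
  have p': "(p has_real_derivative f t - \<mu>\<^sup>2 * ?y t) (at t within {0..})"
    if t: "t \<ge> 0" "t \<notin> N" for t
  proof -
    have "(p has_real_derivative (cos (\<mu> * t) * (cos (\<mu> * t) * f t) - \<mu> * sin (\<mu> * t) * c t)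
        + (sin (\<mu> * t) * (sin (\<mu> * t) * f t) + \<mu> * cos (\<mu> * t) * s t)) (at t within {0..})"
      unfolding p_def by (auto intro!: derivative_eq_intros s'[OF t] c'[OF t])
    also have "cos (\<mu> * t) * (cos (\<mu> * t) * f t) - \<mu> * sin (\<mu> * t) * c t
        + (sin (\<mu> * t) * (sin (\<mu> * t) * f t) + \<mu> * cos (\<mu> * t) * s t)
      = ((sin (\<mu> * t))\<^sup>2 + (cos (\<mu> * t))\<^sup>2) * f t - \<mu> * (sin (\<mu> * t) * c t - cos (\<mu> * t) * s t)"
      unfolding power2_eq_square by (simp only: algebra_simps)
    also have "\<dots> = f t - \<mu>\<^sup>2 * ?y t"
      using \<open>\<mu> \<noteq> 0\<close> by (simp add: power2_eq_square[of \<mu>])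
    finally show ?thesis .
  qed
  show ?thesis
    unfolding oscillator_solution_def
  proof (intro exI[of _ p] conjI allI impI)
    show "absolutely_continuous_on {0..T} p" for T
      using p_lip lipschitz_on_imp_absolutely_continuous_on by blast
    show "AE t in lebesgue. t \<ge> 0 \<longrightarrow>
        (\<exists>y''. (p has_real_derivative y'') (at t within {0..}) \<and> y'' + \<mu>\<^sup>2 * ?y t = f t)"
      unfolding eventually_ae_filter_negligible
    proof (intro exI[of _ N] conjI \<open>negligible N\<close> subsetI)
      fix t assume "t \<in> {t. \<not> (t \<ge> 0 \<longrightarrow>
        (\<exists>y''. (p has_real_derivative y'') (at t within {0..}) \<and> y'' + \<mu>\<^sup>2 * ?y t = f t))}"
      then show "t \<in> N" using p'[of t] by force
    qed
  qed (rule y')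
qed

lemma oscillator_solution_cong:
  assumes "\<And>t. t \<ge> 0 \<Longrightarrow> y t = z t"
  shows "oscillator_solution \<mu> f y \<longleftrightarrow> oscillator_solution \<mu> f z"
proof -
  have "(y has_real_derivative D) (at t within {0..}) \<longleftrightarrow>
      (z has_real_derivative D) (at t within {0..})" if "t \<ge> 0" for D t
    using that assms by (intro has_field_derivative_cong_eventually)
      (auto simp: eventually_at_filter)
  then show ?thesis unfolding oscillator_solution_def using assms by (simp cong: imp_cong)
qed

lemma oscillator_solution_diff:
  assumes "oscillator_solution \<mu> f y" "oscillator_solution \<mu> g z"
  shows "oscillator_solution \<mu> (\<lambda>t. f t - g t) (\<lambda>t. y t - z t)"
proof -
  obtain y' where y: "\<And>t. t \<ge> 0 \<Longrightarrow> (y has_real_derivative y' t) (at t within {0..})"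
      "\<And>T. T \<ge> 0 \<Longrightarrow> absolutely_continuous_on {0..T} y'"
      "AE t in lebesgue. t \<ge> 0 \<longrightarrow>
        (\<exists>y''. (y' has_real_derivative y'') (at t within {0..}) \<and> y'' + \<mu>\<^sup>2 * y t = f t)"
    using assms(1) unfolding oscillator_solution_def by blast
  obtain z' where z: "\<And>t. t \<ge> 0 \<Longrightarrow> (z has_real_derivative z' t) (at t within {0..})"
      "\<And>T. T \<ge> 0 \<Longrightarrow> absolutely_continuous_on {0..T} z'"
      "AE t in lebesgue. t \<ge> 0 \<longrightarrow>
        (\<exists>z''. (z' has_real_derivative z'') (at t within {0..}) \<and> z'' + \<mu>\<^sup>2 * z t = g t)"
    using assms(2) unfolding oscillator_solution_def by blast
  show ?thesis
    unfolding oscillator_solution_def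
  proof (intro exI[of _ "\<lambda>t. y' t - z' t"] conjI allI impI)
    show "AE t in lebesgue. t \<ge> 0 \<longrightarrow>
        (\<exists>w. ((\<lambda>t. y' t - z' t) has_real_derivative w) (at t within {0..}) \<and>
             w + \<mu>\<^sup>2 * (y t - z t) = f t - g t)"
      using y(3) z(3)
    proof (eventually_elim, intro impI)
      fix t :: real
      assume elim: "t \<ge> 0 \<longrightarrow> (\<exists>y''. (y' has_real_derivative y'') (at t within {0..}) \<and> y'' + \<mu>\<^sup>2 * y t = f t)"
        "t \<ge> 0 \<longrightarrow> (\<exists>z''. (z' has_real_derivative z'') (at t within {0..}) \<and> z'' + \<mu>\<^sup>2 * z t = g t)"
        and "t \<ge> 0"
      obtain v w where
        "(y' has_real_derivative v) (at t within {0..})" "v + \<mu>\<^sup>2 * y t = f t"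
        "(z' has_real_derivative w) (at t within {0..})" "w + \<mu>\<^sup>2 * z t = g t"
        using elim \<open>t \<ge> 0\<close> by blast
      then show "\<exists>w. ((\<lambda>t. y' t - z' t) has_real_derivative w) (at t within {0..}) \<and>
             w + \<mu>\<^sup>2 * (y t - z t) = f t - g t"
        by (intro exI[of _ "v - w"]) (auto intro: DERIV_diff simp: algebra_simps)
    qed
  qed (use y z in \<open>auto intro: DERIV_diff absolutely_continuous_on_diff\<close>)
qed

text \<open>For a continuous right-hand side the solution is classical, and \<open>u\<close> and \<open>v\<close> below are constants
  of the motion, by which \<open>z\<close> is a combination of \<open>sin (\<mu> t)\<close> and \<open>cos (\<mu> t)\<close>. So \<open>z\<close> is periodic,
  and a periodic function that tends to zero vanishes.\<close>

lemma homogeneous_oscillator_decaying_eq_0: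
  assumes z: "oscillator_solution \<mu> (\<lambda>_. 0) z" and lim: "(z \<longlongrightarrow> 0) at_top"
    and "\<mu> > 0" "t \<ge> 0"
  shows "z t = 0"
proof -
  obtain z' z'' where z': "\<And>t. t \<ge> 0 \<Longrightarrow> (z has_real_derivative z' t) (at t within {0..})"
      and z'': "\<And>t. t \<ge> 0 \<Longrightarrow> (z' has_real_derivative z'' t) (at t within {0..})"
      and sum0: "\<And>t. t \<ge> 0 \<Longrightarrow> z'' t + \<mu>\<^sup>2 * z t = 0"
    using z oscillator_solution_iff_classical[of "\<lambda>_. 0" \<mu> z] by (auto intro: continuous_on_const)
  have eq: "z'' t = - (\<mu>\<^sup>2 * z t)" if "t \<ge> 0" for t
    using sum0[OF that] by linarith
  define u where "u t = z' t * cos (\<mu> * t) + \<mu> * z t * sin (\<mu> * t)" for t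
  define v where "v t = z' t * sin (\<mu> * t) - \<mu> * z t * cos (\<mu> * t)" for t
  have const: "w t = w 0" if "t \<ge> 0"
      "\<And>t. t \<ge> 0 \<Longrightarrow> (w has_real_derivative 0) (at t within {0..})" for w :: "real \<Rightarrow> real" and t
    using has_field_derivative_zero_constant[of "{0..}" w] that by (metis atLeast_iff order_refl convex_real_interval(1))
  have u: "u t = u 0" if "t \<ge> 0" for t
  proof (rule const[OF that])
    fix t :: real assume t: "t \<ge> 0"
    show "(u has_real_derivative 0) (at t within {0..})"
      unfolding u_def using eq[OF t]
      by (auto intro!: derivative_eq_intros z'[OF t] z''[OF t] simp: power2_eq_square)
  qed
  have v: "v t = v 0" if "t \<ge> 0" for t
  proof (rule const[OF that])
    fix t :: real assume t: "t \<ge> 0"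
    show "(v has_real_derivative 0) (at t within {0..})"
      unfolding v_def using eq[OF t]
      by (auto intro!: derivative_eq_intros z'[OF t] z''[OF t] simp: power2_eq_square)
  qed
  have rep: "\<mu> * z t = u 0 * sin (\<mu> * t) - v 0 * cos (\<mu> * t)" if "t \<ge> 0" for t
  proof -
    have "u t * sin (\<mu> * t) - v t * cos (\<mu> * t) = \<mu> * z t * ((sin (\<mu> * t))\<^sup>2 + (cos (\<mu> * t))\<^sup>2)"
      unfolding u_def v_def by (simp only: algebra_simps power2_eq_square)
    then show ?thesis using u[OF that] v[OF that] by simp
  qed
  define s where "s n = t + real n * (2 * pi / \<mu>)" for n
  have "z (s n) = z t" for n
  proof -
    have "\<mu> * s n = \<mu> * t + 2 * real n * pi" using \<open>\<mu> > 0\<close> by (simp add: s_def field_simps)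
    then have "sin (\<mu> * s n) = sin (\<mu> * t)" "cos (\<mu> * s n) = cos (\<mu> * t)"
      by (simp_all add: sin_add cos_add)
    then have "\<mu> * z (s n) = \<mu> * z t"
      using rep[of "s n"] rep[of t] \<open>t \<ge> 0\<close> \<open>\<mu> > 0\<close> by (simp add: s_def)
    then show ?thesis using \<open>\<mu> > 0\<close> by simp
  qed
  moreover have "filterlim s at_top sequentially"
    unfolding s_def using \<open>\<mu> > 0\<close>
    by (intro filterlim_tendsto_add_at_top[OF tendsto_const]
        filterlim_at_top_mult_tendsto_pos[OF tendsto_const] filterlim_real_sequentially) auto
  ultimately have "(\<lambda>n::nat. z t) \<longlonglongrightarrow> 0"
    using filterlim_compose[OF lim, of s sequentially] by simp
  then show ?thesis by (simp add: LIMSEQ_const_iff)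
qed

theorem corollary2p2:
  fixes \<mu> :: real and f :: "real \<Rightarrow> real"
  assumes "\<mu> > 0"
    and "improper_riemann_convergent (\<lambda>s. sin (\<mu> * s) * f s) 0"
    and "improper_riemann_convergent (\<lambda>s. cos (\<mu> * s) * f s) 0"
  shows "\<exists>!y. y \<in> extensional {0..} \<and> oscillator_solution \<mu> f y \<and> (y \<longlongrightarrow> 0) at_top"
proof -
  obtain s N1 where s: "(s \<longlongrightarrow> 0) at_top" "\<And>T. \<exists>B. B-lipschitz_on {0..T} s" "negligible N1"
    "\<And>t. t \<ge> 0 \<Longrightarrow> t \<notin> N1 \<Longrightarrow> (s has_real_derivative sin (\<mu> * t) * f t) (at t within {0..})"
    using improper_riemann_convergent_primitive[OF assms(2)] by blast
  obtain c N2 where c: "(c \<longlongrightarrow> 0) at_top" "\<And>T. \<exists>B. B-lipschitz_on {0..T} c" "negligible N2"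
    "\<And>t. t \<ge> 0 \<Longrightarrow> t \<notin> N2 \<Longrightarrow> (c has_real_derivative cos (\<mu> * t) * f t) (at t within {0..})"
    using improper_riemann_convergent_primitive[OF assms(3)] by blast
  define y where "y t = (sin (\<mu> * t) * c t - cos (\<mu> * t) * s t) / \<mu>" for t
  have "oscillator_solution \<mu> f y"
    unfolding y_def
    by (rule oscillator_solution_variation_of_constants[of \<mu> "N1 \<union> N2"]) (use s c assms(1) in auto)
  moreover have "(y \<longlongrightarrow> 0) at_top"
  proof (rule Lim_null_comparison)
    have "\<bar>y t\<bar> \<le> (\<bar>c t\<bar> + \<bar>s t\<bar>) / \<mu>" for t
    proof -
      have "\<bar>sin (\<mu> * t) * c t - cos (\<mu> * t) * s t\<bar>
          \<le> \<bar>sin (\<mu> * t)\<bar> * \<bar>c t\<bar> + \<bar>cos (\<mu> * t)\<bar> * \<bar>s t\<bar>"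
        by (metis abs_mult abs_triangle_ineq4)
      also have "\<dots> \<le> 1 * \<bar>c t\<bar> + 1 * \<bar>s t\<bar>"
        by (intro add_mono mult_right_mono) auto
      finally show ?thesis using assms(1) by (simp add: y_def divide_right_mono)
    qed
    then show "\<forall>\<^sub>F t in at_top. norm (y t) \<le> (\<bar>c t\<bar> + \<bar>s t\<bar>) / \<mu>" by simp
    have "((\<lambda>t. (\<bar>c t\<bar> + \<bar>s t\<bar>) / \<mu>) \<longlongrightarrow> (\<bar>0\<bar> + \<bar>0\<bar>) / \<mu>) at_top"
      using assms(1) by (intro tendsto_intros s c) auto
    then show "((\<lambda>t. (\<bar>c t\<bar> + \<bar>s t\<bar>) / \<mu>) \<longlongrightarrow> 0) at_top" by simp
  qed
  moreover have "\<forall>\<^sub>F t in at_top. restrict y {0..} t = y t"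
    using eventually_ge_at_top[of 0] by eventually_elim simp
  ultimately have ex: "oscillator_solution \<mu> f (restrict y {0..})" "(restrict y {0..} \<longlongrightarrow> 0) at_top"
    using oscillator_solution_cong[of "restrict y {0..}" y \<mu> f] by (simp_all add: tendsto_cong)
  show ?thesis
  proof (rule ex1I[of _ "restrict y {0..}"])
    fix z
    assume z: "z \<in> extensional {0..} \<and> oscillator_solution \<mu> f z \<and> (z \<longlongrightarrow> 0) at_top"
    define d where "d t = z t - restrict y {0..} t" for t
    have "oscillator_solution \<mu> (\<lambda>_. 0) d"
      using oscillator_solution_diff[of \<mu> f z f "restrict y {0..}"] z ex(1)
      unfolding d_def by simp
    moreover have "(d \<longlongrightarrow> 0) at_top"
      using tendsto_diff[of z 0 at_top "restrict y {0..}" 0] z ex(2) unfolding d_def by simp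
    ultimately have "d t = 0" if "t \<ge> 0" for t
      using homogeneous_oscillator_decaying_eq_0 assms(1) that by blast
    then show "z = restrict y {0..}"
      using z by (intro extensionalityI[of _ "{0..}"]) (auto simp: d_def)
  qed (use ex in auto)
qed

end
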